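(* There exist a closed set $S\subset\mathbb{R}^3$ with Hausdorff dimension $\dim_{\mathcal{H}}(S)>1$ and a closed cone $C\subset\mathbb{R}^3$ such that $C$ does not contain any plane (two-dimensional vector subspace of $\mathbb{R}^3$) and, for every point $x\in S$, every blow-up of $S$ at $x$ is contained in $C$.
   Context: A cone in $\mathbb{R}^n$ is a set $C\subset\mathbb{R}^n$ such that $\lambda x\in C$ for every $x\in C$ and every $\lambda\ge 0$. $\dim_{\mathcal{H}}$ denotes the Hausdorff dimension with respect to the Euclidean distance. Blow-ups: let $S\subset\mathbb{R}^n$ be closed, $x\in S$, and for $r>0$ set $S_{x,r}:=\overline{B}(0,1)\cap\frac{S-x}{r}$, where $\overline{B}(0,1)$ is the closed unit ball centered at the origin and $\frac{S-x}{r}=\{(y-x)/r : y\in S\}$. A closed set $S_x$ is called a blow-up of $S$ at $x$ if there is a sequence of positive numbers $r_k\searrow 0$ such that the sets $S_{x,r_k}$ converge to $S_x$ in the Hausdorff distance as $k\to\infty$. *)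

theory Defs
  imports "HOL-Analysis.Analysis"
begin

(* The summand diam(U)^s, with the conventions diam(empty)^s = 0 and 0^0 = 1;
   the case s = 0 is separate because 0 powr 0 = 0 in HOL. *)
definition hausdorff_gauge :: "real \<Rightarrow> 'a::metric_space set \<Rightarrow> ennreal" where
  "hausdorff_gauge s U =
     (if U = {} then 0 else if s = 0 then 1 else ennreal (diameter U powr s))"

(* Members of a cover may be empty, so finite covers are included.  Boundedness is
   required explicitly since diameter is unspecified on unbounded sets. *)
definition hausdorff_premeasure :: "real \<Rightarrow> real \<Rightarrow> 'a::metric_space set \<Rightarrow> ennreal" where
  "hausdorff_premeasure s \<delta> A =
     (INF U \<in> {U :: nat \<Rightarrow> 'a set. A \<subseteq> (\<Union>i. U i) \<and> (\<forall>i. bounded (U i) \<and> diameter (U i) \<le> \<delta>)}.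
        (\<Sum>i. hausdorff_gauge s (U i)))"

(* Without the normalising constant, which does not affect the dimension. *)
definition hausdorff_measure :: "real \<Rightarrow> 'a::metric_space set \<Rightarrow> ennreal" where
  "hausdorff_measure s A = (SUP \<delta> \<in> {0<..}. hausdorff_premeasure s \<delta> A)"

definition hausdorff_dim :: "'a::metric_space set \<Rightarrow> ennreal" where
  "hausdorff_dim A = (INF s \<in> {s. 0 \<le> s \<and> hausdorff_measure s A = 0}. ennreal s)"

(* Extended-valued, so the distance between an empty and a nonempty set is \<infinity>. *)
definition hausdorff_dist :: "'a::metric_space set \<Rightarrow> 'a set \<Rightarrow> ennreal" where
  "hausdorff_dist A B =
     max (SUP a\<in>A. INF b\<in>B. ennreal (dist a b)) (SUP b\<in>B. INF a\<in>A. ennreal (dist a b))"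

definition rescaled :: "'a::real_normed_vector set \<Rightarrow> 'a \<Rightarrow> real \<Rightarrow> 'a set" where
  "rescaled S x r = cball 0 1 \<inter> (\<lambda>y. (y - x) /\<^sub>R r) ` S"

definition is_blow_up :: "'a::real_normed_vector set \<Rightarrow> 'a \<Rightarrow> 'a set \<Rightarrow> bool" where
  "is_blow_up S x T \<longleftrightarrow> closed T \<and>
     (\<exists>r :: nat \<Rightarrow> real. (\<forall>k. 0 < r k) \<and> decseq r \<and> r \<longlonglongrightarrow> 0 \<and>
        (\<lambda>k. hausdorff_dist (rescaled S x (r k)) T) \<longlonglongrightarrow> 0)"

end

theory Submission
  imports Defs
begin

text \<open>
  Let \<open>S\<close> be the self-similar set of the four homotheties \<open>p \<mapsto> v + r p\<close>, where \<open>r = 3/10\<close> and \<open>v\<close>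
  runs over the vertices 000, 011, 101, 110 of a regular tetrahedron inscribed in the unit cube.
  Take two points of \<open>S\<close> whose addresses first differ in the \<open>k\<close>-th letter. Their difference is \<open>r ^ k\<close> times an edge vector of the tetrahedron, up to an
  error of at most \<open>r ^ k * (r / (1 - r))\<close> in every coordinate. As \<open>r < 1/3\<close>, this error is too
  small to join the neighbourhoods of different edge directions: all secants of \<open>S\<close> lie in a closed
  cone that surrounds the twelve edge directions by disjoint patches. No great circle fits into
  finitely many disjoint small patches, so the cone contains no plane. As \<open>r > 1/4\<close>, the similarity
  dimension \<open>ln 4 / ln (1/r)\<close> exceeds 1. Thus any ratio strictly between 1/4 and 1/3 would do.

  Each edge vector has one zero coordinate and two coordinates of absolute value 1. Hence a secant has one coordinate that is
  clearly smaller than the two others, which are comparable; \<open>secant_cone\<close> expresses just this.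
  A plane with normal \<open>n\<close> contains vectors with two coordinates equal up to sign, for every pair of
  coordinates. If it lies in the cone, then the third coordinate must be the small one
  (\<open>secant_cone_tie\<close>), and the resulting inequalities force \<open>n = 0\<close>
  (\<open>no_plane_in_secant_cone\<close>).

  The dimension is bounded below without constructing a measure on \<open>S\<close>. Reading the base-4 digits
  of a number in \<open>[0, 1)\<close> as an address gives a map into \<open>S\<close> whose inverse is Hoelder continuous
  with the similarity dimension as exponent, so covers of \<open>S\<close> pull back to covers of \<open>[0, 1)\<close>
  and Lebesgue measure applies (\<open>hausdorff_dim_ge_if_expanding\<close>). The set \<open>S\<close> is obtained as
  the closure of the image, as the secants of a closure stay in a closed cone. Finally, the points
  of every rescaling of \<open>S\<close> are multiples of secants, so the limits stay in the cone
  (\<open>blow_up_subset_cone\<close>).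
\<close>

section \<open>A lower bound for the Hausdorff dimension\<close>

text \<open>
  A cover \<open>U\<close> of \<open>A\<close> yields a cover of the unit interval by the sets of parameters whose image
  lies in \<open>U i\<close>. By the expansion hypothesis such a set fits into an interval of length
  \<open>2 * M * diameter (U i) powr \<alpha>\<close>, so countable subadditivity of Lebesgue measure bounds the sum
  of the gauges from below by \<open>1 / (2 * M)\<close>. Only diameters at most 1 are considered, for which
  passing from the exponent \<open>\<alpha>\<close> down to \<open>s\<close> increases the gauge.
\<close>
lemma hausdorff_measure_nonzero_if_expanding:
  fixes F :: "real \<Rightarrow> 'a::metric_space"
  assumes expand: "\<And>x y. x \<in> {0..<1} \<Longrightarrow> y \<in> {0..<1} \<Longrightarrow> \<bar>x - y\<bar> \<le> M * dist (F x) (F y) powr \<alpha>"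
    and M: "0 < M" and s: "0 \<le> s" "s \<le> \<alpha>" and A: "F ` {0..<1} \<subseteq> A"
  shows "hausdorff_measure s A \<noteq> 0"
proof -
  have bound: "ennreal (1 / (2 * M)) \<le> (\<Sum>i. hausdorff_gauge s (U i))"
    if cover: "A \<subseteq> (\<Union>i. U i)" and U: "\<And>i. bounded (U i)" "\<And>i. diameter (U i) \<le> 1"
    for U :: "nat \<Rightarrow> 'a set"
  proof -
    define l where "l i = M * diameter (U i) powr \<alpha>" for i
    have l0: "0 \<le> l i" for i
      using M by (simp add: l_def)
    have "\<exists>I. I \<in> sets lborel \<and> {x \<in> {0..<1}. F x \<in> U i} \<subseteq> I \<and>
            emeasure lborel I \<le> ennreal (2 * M) * hausdorff_gauge s (U i)" for i
    proof (cases "{x \<in> {0..<1}. F x \<in> U i} = {}")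
      case True
      then show ?thesis by (intro exI[of _ "{}"]) auto
    next
      case False
      then obtain p where p: "p \<in> {0..<1}" "F p \<in> U i" by blast
      have d0: "0 \<le> diameter (U i)"
        using U(1) by (rule diameter_ge_0)
      have "x \<in> {p - l i..p + l i}" if x: "x \<in> {0..<1}" "F x \<in> U i" for x
      proof -
        have "dist (F x) (F p) powr \<alpha> \<le> diameter (U i) powr \<alpha>"
          using s by (intro powr_mono2 diameter_bounded_bound U x p) auto
        then have "\<bar>x - p\<bar> \<le> l i"
          using expand[OF x(1) p(1)] M unfolding l_def
          by (meson mult_left_mono less_imp_le order_trans)
        then show ?thesis by auto
      qed
      then have sub: "{x \<in> {0..<1}. F x \<in> U i} \<subseteq> {p - l i..p + l i}" by blast
      have "ennreal (diameter (U i) powr \<alpha>) \<le> hausdorff_gauge s (U i)"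
      proof (cases "s = 0")
        case True
        then show ?thesis
          using p U(2)[of i] d0 s by (auto simp: hausdorff_gauge_def powr_le1)
      next
        case False
        have "diameter (U i) powr \<alpha> \<le> diameter (U i) powr s"
          using U(2)[of i] d0 s by (intro powr_mono') auto
        then show ?thesis
          using False p by (auto simp: hausdorff_gauge_def intro: ennreal_leI)
      qed
      then have "ennreal (2 * M) * ennreal (diameter (U i) powr \<alpha>)
          \<le> ennreal (2 * M) * hausdorff_gauge s (U i)"
        by (rule mult_left_mono) simp
      moreover have "emeasure lborel {p - l i..p + l i} = ennreal (2 * M) * ennreal (diameter (U i) powr \<alpha>)"
        using l0[of i] M by (simp add: l_def ennreal_mult[symmetric] mult.assoc)
      ultimately show ?thesis
        using sub by (intro exI[of _ "{p - l i..p + l i}"]) auto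
    qed
    then have "\<forall>i. \<exists>I. I \<in> sets lborel \<and> {x \<in> {0..<1}. F x \<in> U i} \<subseteq> I \<and>
            emeasure lborel I \<le> ennreal (2 * M) * hausdorff_gauge s (U i)" ..
    from choice[OF this] obtain I where I: "\<And>i. I i \<in> sets lborel"
        "\<And>i. {x \<in> {0..<1}. F x \<in> U i} \<subseteq> I i"
        "\<And>i. emeasure lborel (I i) \<le> ennreal (2 * M) * hausdorff_gauge s (U i)"
      by blast
    have "{0..<1} \<subseteq> (\<Union>i. I i)"
    proof
      fix x :: real assume x: "x \<in> {0..<1}"
      then have "F x \<in> (\<Union>i. U i)" using A cover by blast
      then obtain i where "F x \<in> U i" by blast
      with x have "x \<in> I i" by (intro I(2)[THEN subsetD]) simp
      then show "x \<in> (\<Union>i. I i)" by blast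
    qed
    then have "emeasure lborel {0..<1::real} \<le> emeasure lborel (\<Union>i. I i)"
      using I(1) by (intro emeasure_mono) auto
    also have "\<dots> \<le> (\<Sum>i. emeasure lborel (I i))"
      using I(1) by (intro emeasure_subadditive_countably) auto
    also have "\<dots> \<le> (\<Sum>i. ennreal (2 * M) * hausdorff_gauge s (U i))"
      by (intro suminf_le I(3)) auto
    also have "\<dots> = ennreal (2 * M) * (\<Sum>i. hausdorff_gauge s (U i))"
      by simp
    finally have "1 \<le> ennreal (2 * M) * (\<Sum>i. hausdorff_gauge s (U i))" by simp
    then have "ennreal (1 / (2 * M)) * 1
        \<le> ennreal (1 / (2 * M)) * (ennreal (2 * M) * (\<Sum>i. hausdorff_gauge s (U i)))"
      by (rule mult_left_mono) simp
    also have "\<dots> = (\<Sum>i. hausdorff_gauge s (U i))"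
      using M by (simp add: mult.assoc[symmetric] ennreal_mult[symmetric])
    finally show ?thesis by simp
  qed
  have "ennreal (1 / (2 * M)) \<le> hausdorff_premeasure s 1 A"
    unfolding hausdorff_premeasure_def by (intro INF_greatest) (auto intro: bound)
  also have "\<dots> \<le> hausdorff_measure s A"
    unfolding hausdorff_measure_def by (intro SUP_upper) auto
  finally show ?thesis
    using M by auto
qed

lemma hausdorff_dim_ge_if_expanding:
  fixes F :: "real \<Rightarrow> 'a::metric_space"
  assumes "\<And>x y. x \<in> {0..<1} \<Longrightarrow> y \<in> {0..<1} \<Longrightarrow> \<bar>x - y\<bar> \<le> M * dist (F x) (F y) powr \<alpha>"
    and "0 < M" and "F ` {0..<1} \<subseteq> A"
  shows "ennreal \<alpha> \<le> hausdorff_dim A"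
  unfolding hausdorff_dim_def
proof (intro INF_greatest)
  fix s assume "s \<in> {s. 0 \<le> s \<and> hausdorff_measure s A = 0}"
  then have "\<not> s \<le> \<alpha>"
    using hausdorff_measure_nonzero_if_expanding[OF assms(1,2) _ _ assms(3)] by blast
  then show "ennreal \<alpha> \<le> ennreal s"
    by (intro ennreal_leI) simp
qed

section \<open>Blow-ups and secants\<close>

text \<open>
  A cone absorbs the rescaling factor, so every rescaled set lies in \<open>C\<close>. Only one half of the
  Hausdorff distance matters: each point of \<open>T\<close> is approximated by points of rescaled sets.
\<close>
lemma blow_up_subset_cone:
  fixes S C :: "'a::real_normed_vector set"
  assumes C: "closed C" "cone C" and secant: "\<And>y. y \<in> S \<Longrightarrow> y - x \<in> C"
    and T: "is_blow_up S x T"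
  shows "T \<subseteq> C"
proof
  fix b assume b: "b \<in> T"
  obtain r where r: "\<And>k. 0 < r k"
      and lim: "(\<lambda>k. hausdorff_dist (rescaled S x (r k)) T) \<longlonglongrightarrow> 0"
    using T by (auto simp: is_blow_up_def)
  have "\<exists>a\<in>C. dist a b < e" if e: "0 < e" for e
  proof -
    have "\<forall>\<^sub>F k in sequentially. hausdorff_dist (rescaled S x (r k)) T < ennreal e"
      using e by (intro order_tendstoD(2)[OF lim]) auto
    then obtain k where k: "hausdorff_dist (rescaled S x (r k)) T < ennreal e"
      using eventually_sequentially by auto
    have "(INF a\<in>rescaled S x (r k). ennreal (dist a b)) \<le> hausdorff_dist (rescaled S x (r k)) T"
      unfolding hausdorff_dist_def using b by (intro max.coboundedI2 SUP_upper)
    with k have "(INF a\<in>rescaled S x (r k). ennreal (dist a b)) < ennreal e"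
      by (rule le_less_trans[rotated])
    then obtain a where a: "a \<in> rescaled S x (r k)" "ennreal (dist a b) < ennreal e"
      by (auto simp: INF_less_iff)
    then obtain y where y: "y \<in> S" "a = (y - x) /\<^sub>R r k"
      by (auto simp: rescaled_def)
    have "a \<in> C"
      using C(2) secant[OF y(1)] r[of k] unfolding y(2) cone_def by simp
    moreover have "dist a b < e"
      using a(2) by (simp add: ennreal_less_iff)
    ultimately show ?thesis by blast
  qed
  then have "b \<in> closure C"
    by (auto simp: closure_approachable)
  then show "b \<in> C" using C(1) by simp
qed

section \<open>The cone\<close>

text \<open>
  The constants come from \<open>r / (1 - r) = 3/7\<close> for \<open>r = 3/10\<close>: at the scale of the first difference,
  the small coordinate of a secant is at most 3/7, and the two large ones lie between
  \<open>1 - 3/7 = 4/7\<close> and \<open>1 + 3/7 = 10/7\<close>. Comparability (the factor 5/2) is what keeps the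
  coordinate axes out of the cone.
\<close>
definition secant_cone :: "(real^3) set" where
  "secant_cone = {x. \<exists>i. \<forall>j. j \<noteq> i \<longrightarrow>
     \<bar>x $ i\<bar> \<le> 3/4 * \<bar>x $ j\<bar> \<and> (\<forall>k. \<bar>x $ k\<bar> \<le> 5/2 * \<bar>x $ j\<bar>)}"

lemma closed_secant_cone: "closed secant_cone"
proof -
  have closed_ij: "closed {x::real^3. j \<noteq> i \<longrightarrow>
     \<bar>x $ i\<bar> \<le> 3/4 * \<bar>x $ j\<bar> \<and> (\<forall>k. \<bar>x $ k\<bar> \<le> 5/2 * \<bar>x $ j\<bar>)}" for i j
    by (cases "j = i") 
      (auto intro!: closed_Collect_conj closed_Collect_all closed_Collect_le continuous_intros)
  then have "closed (\<Union>i. {x::real^3. \<forall>j. j \<noteq> i \<longrightarrow>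
     \<bar>x $ i\<bar> \<le> 3/4 * \<bar>x $ j\<bar> \<and> (\<forall>k. \<bar>x $ k\<bar> \<le> 5/2 * \<bar>x $ j\<bar>)})"
    by (intro closed_UN ballI closed_Collect_all closed_ij) simp
  also have "(\<Union>i. {x::real^3. \<forall>j. j \<noteq> i \<longrightarrow>
     \<bar>x $ i\<bar> \<le> 3/4 * \<bar>x $ j\<bar> \<and> (\<forall>k. \<bar>x $ k\<bar> \<le> 5/2 * \<bar>x $ j\<bar>)}) = secant_cone"
    by (auto simp: secant_cone_def)
  finally show ?thesis .
qed

lemma cone_secant_cone: "cone secant_cone"
  unfolding cone_def
proof (intro ballI allI impI)
  fix x :: "real^3" and c :: real
  assume "x \<in> secant_cone" and c: "0 \<le> c"
  then obtain i where i: "\<And>j. j \<noteq> i \<Longrightarrow> \<bar>x $ i\<bar> \<le> 3/4 * \<bar>x $ j\<bar>"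
      "\<And>j k. j \<noteq> i \<Longrightarrow> \<bar>x $ k\<bar> \<le> 5/2 * \<bar>x $ j\<bar>"
    by (auto simp: secant_cone_def)
  have "c * \<bar>x $ i\<bar> \<le> c * (3/4 * \<bar>x $ j\<bar>)" "c * \<bar>x $ k\<bar> \<le> c * (5/2 * \<bar>x $ j\<bar>)"
    if "j \<noteq> i" for j k
    using i[OF that] c by (intro mult_left_mono; simp)+
  then show "c *\<^sub>R x \<in> secant_cone"
    using c unfolding secant_cone_def
    by (auto simp: abs_mult mult.left_commute intro!: exI[of _ i])
qed

text \<open>
  A strictly smallest coordinate cannot be one of two tied coordinates. The exception would be
  that both vanish; then the comparability of the two large coordinates makes the vector zero.
\<close>
lemma secant_cone_tie:
  assumes "x \<in> secant_cone" "a \<noteq> b" "c \<noteq> a" "c \<noteq> b" "\<bar>x $ a\<bar> = \<bar>x $ b\<bar>"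
  shows "\<bar>x $ c\<bar> \<le> 3/4 * \<bar>x $ a\<bar>"
proof -
  obtain i where i: "\<And>j. j \<noteq> i \<Longrightarrow> \<bar>x $ i\<bar> \<le> 3/4 * \<bar>x $ j\<bar>"
      "\<And>j k. j \<noteq> i \<Longrightarrow> \<bar>x $ k\<bar> \<le> 5/2 * \<bar>x $ j\<bar>"
    using assms(1) by (auto simp: secant_cone_def)
  show ?thesis
  proof (cases "i = a \<or> i = b")
    case True
    then have "\<bar>x $ a\<bar> = 0" "\<bar>x $ b\<bar> = 0"
      using i(1)[of a] i(1)[of b] assms by auto
    then show ?thesis
      using True i(2)[of a c] i(2)[of b c] assms by auto
  next
    case False
    have "i = c"
      using False assms by (smt (verit) UNIV_3 exhaust_3)
    then show ?thesis using i(1)[of a] assms by auto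
  qed
qed

text \<open>
  The vectors below are orthogonal to the normal \<open>n\<close> and have two coordinates of equal absolute
  value, so the third one is at most 3/4 of it. This gives \<open>\<bar>n$1\<bar> + \<bar>n$2\<bar> \<le> 3/4 * \<bar>n$3\<bar>\<close> and
  \<open>\<bar>n$2\<bar> + \<bar>n$3\<bar> \<le> 3/4 * \<bar>n$1\<bar>\<close>, whose sum is impossible unless \<open>n = 0\<close>.
\<close>
lemma no_plane_in_secant_cone:
  assumes V: "subspace V" "dim V = 2"
  shows "\<not> V \<subseteq> secant_cone"
proof
  assume sub: "V \<subseteq> secant_cone"
  have "dim V = DIM(real^3) - 1" using V by simp
  then obtain n :: "real^3" where n: "n \<noteq> 0" "span V = {x. n \<bullet> x = 0}"
    by (rule lowdim_eq_hyperplane)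
  then have "V = {x. n \<bullet> x = 0}"
    using V by (simp add: span_eq_iff[THEN iffD2])
  with sub have C: "x \<in> secant_cone" if "n \<bullet> x = 0" for x
    using that by auto
  have "\<bar>n$1 + n$2\<bar> \<le> 3/4 * \<bar>n$3\<bar>"
    using secant_cone_tie[OF C, of "vector [- n$3, - n$3, n$1 + n$2]" 1 2 3]
    by (auto simp: inner_vec_def sum_3 algebra_simps)
  moreover have "\<bar>n$1 - n$2\<bar> \<le> 3/4 * \<bar>n$3\<bar>"
    using secant_cone_tie[OF C, of "vector [n$3, - n$3, n$2 - n$1]" 1 2 3]
    by (auto simp: inner_vec_def sum_3 algebra_simps abs_minus_commute)
  moreover have "\<bar>n$2 + n$3\<bar> \<le> 3/4 * \<bar>n$1\<bar>"
    using secant_cone_tie[OF C, of "vector [n$2 + n$3, - n$1, - n$1]" 2 3 1]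
    by (auto simp: inner_vec_def sum_3 algebra_simps)
  moreover have "\<bar>n$2 - n$3\<bar> \<le> 3/4 * \<bar>n$1\<bar>"
    using secant_cone_tie[OF C, of "vector [n$3 - n$2, n$1, - n$1]" 2 3 1]
    by (auto simp: inner_vec_def sum_3 algebra_simps abs_minus_commute)
  ultimately have "n$1 = 0 \<and> n$2 = 0 \<and> n$3 = 0" by linarith
  then show False
    using n(1) by (simp add: vec_eq_iff forall_3)
qed

section \<open>The self-similar set\<close>

text \<open>The base-4 digits after the point of a number in \<open>[0, 1)\<close>.\<close>
definition digit :: "nat \<Rightarrow> real \<Rightarrow> int" where
  "digit k x = \<lfloor>4 ^ Suc k * x\<rfloor> - 4 * \<lfloor>4 ^ k * x\<rfloor>"

text \<open>Vertices of a regular tetrahedron inscribed in the unit cube.\<close>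
definition vertex :: "int \<Rightarrow> real^3" where
  "vertex d = (if d = 0 then vector [0, 0, 0] else if d = 1 then vector [0, 1, 1]
     else if d = 2 then vector [1, 0, 1] else vector [1, 1, 0])"

text \<open>
  The point with address \<open>digit 0 x, digit 1 x, \<dots>\<close> under the four homotheties
  \<open>p \<mapsto> vertex d + (3/10) p\<close>.
\<close>
definition limit_point :: "real \<Rightarrow> real^3" where
  "limit_point x = (\<chi> i. \<Sum>k. (3/10) ^ k * vertex (digit k x) $ i)"

lemma digit_range: "digit k x \<in> {0, 1, 2, 3}"
proof -
  have "0 \<le> digit k x" "digit k x < 4"
    unfolding digit_def by (simp_all add: mult.assoc) linarith+
  then show ?thesis by auto
qed

lemma vertex_coord: "vertex d $ i \<in> {0, 1}"
  using exhaust_3[of i] by (auto simp: vertex_def)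

lemma vertices_differ_in_two_coords:
  assumes "d \<noteq> e" "d \<in> {0, 1, 2, 3}" "e \<in> {0, 1, 2, 3}"
  obtains i where "vertex d $ i = vertex e $ i"
    "\<And>j. j \<noteq> i \<Longrightarrow> \<bar>vertex d $ j - vertex e $ j\<bar> = 1"
proof -
  have ex3: "(\<exists>i::3. P i) \<longleftrightarrow> P 1 \<or> P 2 \<or> P 3" for P
    by (metis exhaust_3)
  have "\<exists>i. vertex d $ i = vertex e $ i \<and> (\<forall>j. j \<noteq> i \<longrightarrow> \<bar>vertex d $ j - vertex e $ j\<bar> = 1)"
    using assms by (auto simp: vertex_def forall_3 ex3)
  with that show ?thesis by blast
qed

text \<open>Beyond the first difference, the terms are dominated by a geometric series.\<close>
lemma geometric_digits_diff:
  fixes a b :: "nat \<Rightarrow> real"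
  assumes r: "0 < r" "r < 1" and ab: "\<And>j. a j \<in> {0, 1}" "\<And>j. b j \<in> {0, 1}"
    and eq: "\<And>j. j < k \<Longrightarrow> a j = b j"
  shows "\<bar>(\<Sum>j. r ^ j * a j) - (\<Sum>j. r ^ j * b j) - r ^ k * (a k - b k)\<bar> \<le> r ^ k * (r / (1 - r))"
proof -
  have sg: "summable (\<lambda>j. r ^ j)"
    using r by (intro summable_geometric) auto
  have sm: "summable (\<lambda>j. r ^ j * c j)" if "\<And>j. \<bar>c j\<bar> \<le> 1" for c :: "nat \<Rightarrow> real"
    using r that by (intro summable_comparison_test'[OF sg]) (auto simp: abs_mult intro: mult_left_le)
  have 1: "\<bar>a j\<bar> \<le> 1" "\<bar>b j\<bar> \<le> 1" "\<bar>a j - b j\<bar> \<le> 1" for j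
    using ab(1)[of j] ab(2)[of j] by auto
  define t where "t j = r ^ j * (a j - b j)" for j
  have st: "summable t"
    unfolding t_def by (intro sm 1)
  have "(\<Sum>j. r ^ j * a j) - (\<Sum>j. r ^ j * b j) = (\<Sum>j. t j)"
    unfolding t_def by (simp add: suminf_diff sm 1 right_diff_distrib)
  also have "\<dots> = (\<Sum>j. t (j + Suc k)) + (\<Sum>j<Suc k. t j)"
    by (rule suminf_split_initial_segment[OF st])
  also have "(\<Sum>j<Suc k. t j) = t k"
    using eq by (simp add: t_def)
  finally have *: "(\<Sum>j. r ^ j * a j) - (\<Sum>j. r ^ j * b j) - r ^ k * (a k - b k)
      = (\<Sum>j. t (j + Suc k))"
    by (simp add: t_def)
  have "norm (\<Sum>j. t (j + Suc k)) \<le> (\<Sum>j. r ^ Suc k * r ^ j)"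
  proof (rule norm_suminf_le)
    show "norm (t (j + Suc k)) \<le> r ^ Suc k * r ^ j" for j
      using r mult_left_mono[OF 1(3)[of "j + Suc k"], of "r ^ (j + Suc k)"]
      by (simp add: t_def abs_mult power_add mult_ac)
  qed (use sg in \<open>rule summable_mult\<close>)
  also have "\<dots> = r ^ k * (r / (1 - r))"
    using r by (subst suminf_mult[OF sg]) (simp add: suminf_geometric)
  finally show ?thesis
    unfolding * by simp
qed

text \<open>
  Let \<open>Suc k\<close> be the least \<open>n\<close> such that \<open>x\<close> and \<open>y\<close> lie in different 4-adic intervals of length
  \<open>(1/4) ^ n\<close>. Since the two numbers still share such an interval at level \<open>k\<close>, they are close.
\<close>
lemma first_distinct_digit:
  assumes x: "x \<in> {0..<1}" and y: "y \<in> {0..<1}" and "x \<noteq> y"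
  obtains k where "\<And>j. j < k \<Longrightarrow> digit j x = digit j y" "digit k x \<noteq> digit k y"
    "\<bar>x - y\<bar> \<le> (1/4) ^ k"
proof -
  define P where "P n \<longleftrightarrow> \<lfloor>4 ^ n * x\<rfloor> \<noteq> \<lfloor>4 ^ n * y\<rfloor>" for n
  obtain m where "1 / \<bar>x - y\<bar> < 4 ^ m"
    using real_arch_pow[of 4 "1 / \<bar>x - y\<bar>"] by auto
  then have "1 < \<bar>4 ^ m * x - 4 ^ m * y\<bar>"
    using assms(3) by (simp add: divide_less_eq abs_mult right_diff_distrib[symmetric])
  then have "P m" unfolding P_def by linarith
  define n where "n = (LEAST n. P n)"
  have n: "P n" "\<And>j. j < n \<Longrightarrow> \<not> P j"
    unfolding n_def using \<open>P m\<close> by (auto intro: LeastI dest: not_less_Least)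
  have "\<not> P 0"
    using x y by (simp add: P_def floor_eq_iff[of _ 0, THEN iffD2])
  with n(1) obtain k where k: "n = Suc k"
    by (cases n) auto
  have le: "\<lfloor>4 ^ j * x\<rfloor> = \<lfloor>4 ^ j * y\<rfloor>" if "j \<le> k" for j
    using n(2)[of j] that k by (simp add: P_def)
  show thesis
  proof
    show "digit j x = digit j y" if "j < k" for j
      using le[of j] le[of "Suc j"] that by (simp add: digit_def)
    show "digit k x \<noteq> digit k y"
      using le[of k] n(1) by (simp add: digit_def P_def k)
    have "\<bar>4 ^ k * x - 4 ^ k * y\<bar> \<le> 1"
      using le[of k] by linarith
    then have "4 ^ k * \<bar>x - y\<bar> \<le> 1"
      by (simp add: abs_mult right_diff_distrib[symmetric])
    then show "\<bar>x - y\<bar> \<le> (1/4) ^ k"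
      by (simp add: power_one_over field_simps)
  qed
qed

text \<open>
  At the scale \<open>(3/10) ^ k\<close> of the first distinct digit, the secant is an edge of the tetrahedron
  perturbed by at most 3/7 in each coordinate. This gives both its direction and a lower bound
  for its length.
\<close>
lemma limit_point_secant:
  assumes x: "x \<in> {0..<1}" and y: "y \<in> {0..<1}" and "x \<noteq> y"
  obtains k where "limit_point x - limit_point y \<in> secant_cone"
    "4/7 * (3/10) ^ k \<le> dist (limit_point x) (limit_point y)" "\<bar>x - y\<bar> \<le> (1/4) ^ k"
proof -
  obtain k where k: "\<And>j. j < k \<Longrightarrow> digit j x = digit j y" "digit k x \<noteq> digit k y"
      "\<bar>x - y\<bar> \<le> (1/4) ^ k"
    using first_distinct_digit[OF assms] by metis
  obtain i where i: "vertex (digit k x) $ i = vertex (digit k y) $ i"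
      "\<And>j. j \<noteq> i \<Longrightarrow> \<bar>vertex (digit k x) $ j - vertex (digit k y) $ j\<bar> = 1"
    using vertices_differ_in_two_coords[OF k(2) digit_range digit_range] by metis
  define z where "z = limit_point x - limit_point y"
  define q :: real where "q = (3/10) ^ k"
  have q: "0 < q" by (simp add: q_def)
  have near: "\<bar>z $ j - q * (vertex (digit k x) $ j - vertex (digit k y) $ j)\<bar> \<le> 3/7 * q" for j
    using geometric_digits_diff[of "3/10" "\<lambda>m. vertex (digit m x) $ j" "\<lambda>m. vertex (digit m y) $ j" k]
      vertex_coord k(1)
    by (simp add: z_def q_def limit_point_def)
  have small: "\<bar>z $ i\<bar> \<le> 3/7 * q"
    using near[of i] i(1) by simp
  have large: "4/7 * q \<le> \<bar>z $ j\<bar>" "\<bar>z $ j\<bar> \<le> 10/7 * q" if "j \<noteq> i" for j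
  proof -
    have "\<bar>q * (vertex (digit k x) $ j - vertex (digit k y) $ j)\<bar> = q"
      using i(2)[OF that] q by (simp add: abs_mult)
    then show "4/7 * q \<le> \<bar>z $ j\<bar>" "\<bar>z $ j\<bar> \<le> 10/7 * q"
      using near[of j] by linarith+
  qed
  have "\<bar>z $ i\<bar> \<le> 3/4 * \<bar>z $ j\<bar> \<and> (\<forall>m. \<bar>z $ m\<bar> \<le> 5/2 * \<bar>z $ j\<bar>)" if "j \<noteq> i" for j
  proof (intro conjI allI)
    show "\<bar>z $ i\<bar> \<le> 3/4 * \<bar>z $ j\<bar>"
      using small large(1)[OF that] by linarith
    show "\<bar>z $ m\<bar> \<le> 5/2 * \<bar>z $ j\<bar>" for m
      using small large(1)[OF that] large(2)[of m] q by (cases "m = i") (simp, linarith)+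
  qed
  then have "z \<in> secant_cone"
    unfolding secant_cone_def by blast
  moreover obtain j where "j \<noteq> i"
    using exhaust_3[of i] by (metis zero_neq_one one_neq_zero)
  then have "4/7 * q \<le> norm z"
    using large(1) component_le_norm_cart[of z j] by (meson order_trans)
  ultimately show ?thesis
    using that k(3) by (simp add: z_def q_def dist_norm)
qed

lemma closure_diff_in_closed:
  fixes A C :: "'a::real_normed_vector set"
  assumes "closed C" and diff: "\<And>x y. x \<in> A \<Longrightarrow> y \<in> A \<Longrightarrow> x - y \<in> C"
    and "x \<in> closure A" "y \<in> closure A"
  shows "x - y \<in> C"
proof -
  obtain f g where f: "\<And>n. f n \<in> A" "f \<longlonglongrightarrow> x" and g: "\<And>n. g n \<in> A" "g \<longlonglongrightarrow> y"
    using assms(3,4) by (auto simp: closure_sequential)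
  have "(\<lambda>n. f n - g n) \<longlonglongrightarrow> x - y"
    by (intro tendsto_diff f g)
  then show ?thesis
    using closed_sequentially[OF assms(1), of "\<lambda>n. f n - g n"] diff f(1) g(1) by blast
qed

theorem mainTheorem2:
  shows "\<exists>S C :: (real^3) set.
    closed S \<and> hausdorff_dim S > 1 \<and>
    closed C \<and> cone C \<and>
    \<not> (\<exists>V. subspace V \<and> dim V = 2 \<and> V \<subseteq> C) \<and>
    (\<forall>x\<in>S. \<forall>T. is_blow_up S x T \<longrightarrow> T \<subseteq> C)"
proof (rule exI[of _ "closure (limit_point ` {0..<1})"], rule exI[of _ secant_cone],
    intro conjI ballI allI impI)
  let ?S = "closure (limit_point ` {0..<1})"
  define \<alpha> :: real where "\<alpha> = log (10/3) 4"
  have \<alpha>: "1 < \<alpha>" by (simp add: \<alpha>_def)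
  \<comment> \<open>\<open>\<alpha>\<close> is the similarity dimension: it converts the contraction ratio 3/10 into 1/4.\<close>
  have similarity: "(1/4) ^ k = ((3/10) ^ k) powr \<alpha>" for k
  proof -
    have "(10/3) powr \<alpha> = 4" by (simp add: \<alpha>_def)
    then have "(3/10::real) powr \<alpha> = 1/4"
      using powr_divide[of 1 "10/3" \<alpha>] by simp
    have "((3/10) ^ k) powr \<alpha> = ((3/10::real) powr \<alpha>) powr real k"
      by (simp add: powr_realpow[symmetric] powr_powr mult.commute)
    also have "\<dots> = (1/4) ^ k"
      unfolding \<open>(3/10) powr \<alpha> = 1/4\<close> by (rule powr_realpow) simp
    finally show ?thesis ..
  qed
  have "ennreal \<alpha> \<le> hausdorff_dim ?S"
  proof (rule hausdorff_dim_ge_if_expanding)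
    fix x y :: real assume xy: "x \<in> {0..<1}" "y \<in> {0..<1}"
    show "\<bar>x - y\<bar> \<le> (7/4) powr \<alpha> * dist (limit_point x) (limit_point y) powr \<alpha>"
    proof (cases "x = y")
      case False
      obtain k where k: "4/7 * (3/10) ^ k \<le> dist (limit_point x) (limit_point y)"
          "\<bar>x - y\<bar> \<le> (1/4) ^ k"
        using limit_point_secant[OF xy False] by metis
      have "\<bar>x - y\<bar> \<le> ((3/10) ^ k) powr \<alpha>"
        using k(2) by (simp add: similarity)
      also have "\<dots> \<le> (7/4 * dist (limit_point x) (limit_point y)) powr \<alpha>"
        using k(1) \<alpha> by (intro powr_mono2) auto
      finally show ?thesis by (simp only: powr_mult)
    qed auto
  qed (auto intro: closure_subset[THEN subsetD])
  moreover have "1 < ennreal \<alpha>"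
    using \<alpha> by simp
  ultimately show "1 < hausdorff_dim ?S"
    by (rule less_le_trans[rotated])
  have "p - q \<in> secant_cone" if "p \<in> limit_point ` {0..<1}" "q \<in> limit_point ` {0..<1}" for p q
  proof -
    obtain x y where xy: "p = limit_point x" "q = limit_point y" "x \<in> {0..<1}" "y \<in> {0..<1}"
      using \<open>p \<in> limit_point ` {0..<1}\<close> \<open>q \<in> limit_point ` {0..<1}\<close> by blast
    show ?thesis
    proof (cases "x = y")
      case True
      then show ?thesis by (simp add: xy secant_cone_def)
    next
      case False
      then show ?thesis
        using limit_point_secant[OF xy(3,4)] xy(1,2) by metis
    qed
  qed
  then have "y - x \<in> secant_cone" if "x \<in> ?S" "y \<in> ?S" for x y
    using closure_diff_in_closed[OF closed_secant_cone] that by blast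
  then show "T \<subseteq> secant_cone" if "x \<in> ?S" "is_blow_up ?S x T" for x T
    using that by (intro blow_up_subset_cone[OF closed_secant_cone cone_secant_cone]) auto
  show "\<not> (\<exists>V. subspace V \<and> dim V = 2 \<and> V \<subseteq> secant_cone)"
    using no_plane_in_secant_cone by blast
qed (use closed_secant_cone cone_secant_cone in auto)

end
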